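(* Let $\mathfrak g$ be a finite dimensional simple Lie algebra over $F$ and let $L(\mathfrak g)=F[t,t^{-1}]\otimes\mathfrak g$ be its loop algebra. Then $r_b(L(\mathfrak g))=0$.
   Context: $F$ is an algebraically closed field of characteristic zero; all Lie algebras are over $F$ and may be infinite dimensional. The bracket on the loop algebra is $[t^m\otimes x,t^n\otimes y]=t^{m+n}\otimes[x,y]$ for $m,n\in\mathbb Z$, $x,y\in\mathfrak g$. Baer radical. A homomorphic image of a Lie algebra $L$ is a Lie algebra onto which $L$ maps by a surjective Lie homomorphism. Let $\mathbb E$ be the class of nilpotent Lie algebras. For a well-ordered set $I$ with least element $1$ and a maximal element, define classes $\mathbb E_\alpha$ ($\alpha\in I$) by transfinite recursion: $\mathbb E_1$ is the class of all homomorphic images of members of $\mathbb E$; if $\alpha>1$ is a limit element (no immediate predecessor), $\mathbb E_\alpha=\bigcup_{\beta<\alpha}\mathbb E_\beta$; if $\alpha>1$ has an immediate predecessor $\alpha-1$, $\mathbb E_\alpha$ is the class of Lie algebras $L$ such that every non-zero homomorphic image of $L$ has a non-zero ideal belonging to $\mathbb E_{\alpha-1}$. Put $\mathbb E_I=\bigcup_{\alpha\in I}\mathbb E_\alpha$. A Lie algebra $L$ is an $r_b$-Lie algebra if $L\in\mathbb E_I$ for some such $I$ with $\operatorname{card} I>\operatorname{card} 2^L$ ($2^L$ is the power set of $L$). An $r_b$-ideal of $L$ is an ideal which is an $r_b$-Lie algebra, and $r_b(L)$, the Baer radical, denotes the largest $r_b$-ideal of $L$ (the sum of all $r_b$-ideals).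 *)

theory Defs
  imports "HOL-Algebra.Algebra"
begin

unbundle cardinal_syntax

section \<open>Lie algebras\<close>

text \<open>The fields \<open>mult\<close> and \<open>one\<close> inherited from the HOL-Algebra record of modules carry no
  meaning (as for modules) and are never used.\<close>

record ('f, 'a) lie_alg = "('f, 'a) module" +
  bracket :: "'a \<Rightarrow> 'a \<Rightarrow> 'a"

locale lie_algebra = module F L + field F
  for F :: "('f, 'm) ring_scheme" (structure) and L :: "('f, 'a) lie_alg" (structure) +
  assumes bracket_closed [simp, intro]:
      "\<lbrakk>x \<in> carrier L; y \<in> carrier L\<rbrakk> \<Longrightarrow> bracket L x y \<in> carrier L"
    and bracket_add_left:
      "\<lbrakk>x \<in> carrier L; y \<in> carrier L; z \<in> carrier L\<rbrakk> \<Longrightarrow>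
        bracket L (x \<oplus>\<^bsub>L\<^esub> y) z = bracket L x z \<oplus>\<^bsub>L\<^esub> bracket L y z"
    and bracket_add_right:
      "\<lbrakk>x \<in> carrier L; y \<in> carrier L; z \<in> carrier L\<rbrakk> \<Longrightarrow>
        bracket L x (y \<oplus>\<^bsub>L\<^esub> z) = bracket L x y \<oplus>\<^bsub>L\<^esub> bracket L x z"
    and bracket_smult_left:
      "\<lbrakk>a \<in> carrier F; x \<in> carrier L; y \<in> carrier L\<rbrakk> \<Longrightarrow>
        bracket L (a \<odot>\<^bsub>L\<^esub> x) y = a \<odot>\<^bsub>L\<^esub> bracket L x y"
    and bracket_smult_right:
      "\<lbrakk>a \<in> carrier F; x \<in> carrier L; y \<in> carrier L\<rbrakk> \<Longrightarrow>
        bracket L x (a \<odot>\<^bsub>L\<^esub> y) = a \<odot>\<^bsub>L\<^esub> bracket L x y"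
    and bracket_self: "x \<in> carrier L \<Longrightarrow> bracket L x x = \<zero>\<^bsub>L\<^esub>"
    and jacobi:
      "\<lbrakk>x \<in> carrier L; y \<in> carrier L; z \<in> carrier L\<rbrakk> \<Longrightarrow>
        bracket L x (bracket L y z) \<oplus>\<^bsub>L\<^esub> bracket L y (bracket L z x)
          \<oplus>\<^bsub>L\<^esub> bracket L z (bracket L x y) = \<zero>\<^bsub>L\<^esub>"

definition nonzero_lie :: "('f, 'a) lie_alg \<Rightarrow> bool" where
  "nonzero_lie L \<longleftrightarrow> carrier L \<noteq> {\<zero>\<^bsub>L\<^esub>}"

definition linear_span :: "('f, 'm) ring_scheme \<Rightarrow> ('f, 'a) lie_alg \<Rightarrow> 'a set \<Rightarrow> 'a set" where
  "linear_span F L S = \<Inter>{N. submodule N F L \<and> S \<subseteq> N}"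

definition finite_dimensional :: "('f, 'm) ring_scheme \<Rightarrow> ('f, 'a) lie_alg \<Rightarrow> bool" where
  "finite_dimensional F L \<longleftrightarrow>
    (\<exists>B. finite B \<and> B \<subseteq> carrier L \<and> linear_span F L B = carrier L)"

definition lie_ideal :: "('f, 'm) ring_scheme \<Rightarrow> ('f, 'a) lie_alg \<Rightarrow> 'a set \<Rightarrow> bool" where
  "lie_ideal F L I \<longleftrightarrow>
    submodule I F L \<and> (\<forall>x\<in>carrier L. \<forall>y\<in>I. bracket L x y \<in> I)"

definition simple_lie_algebra :: "('f, 'm) ring_scheme \<Rightarrow> ('f, 'a) lie_alg \<Rightarrow> bool" where
  "simple_lie_algebra F L \<longleftrightarrow> lie_algebra F L \<and>
    (\<exists>x\<in>carrier L. \<exists>y\<in>carrier L. bracket L x y \<noteq> \<zero>\<^bsub>L\<^esub>) \<and>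
    (\<forall>I. lie_ideal F L I \<longrightarrow> I = {\<zero>\<^bsub>L\<^esub>} \<or> I = carrier L)"

primrec lower_central :: "('f, 'm) ring_scheme \<Rightarrow> ('f, 'a) lie_alg \<Rightarrow> nat \<Rightarrow> 'a set" where
  "lower_central F L 0 = carrier L"
| "lower_central F L (Suc k) =
    linear_span F L {bracket L x y | x y. x \<in> carrier L \<and> y \<in> lower_central F L k}"

definition nilpotent_lie_algebra :: "('f, 'm) ring_scheme \<Rightarrow> ('f, 'a) lie_alg \<Rightarrow> bool" where
  "nilpotent_lie_algebra F L \<longleftrightarrow> lie_algebra F L \<and> (\<exists>k. lower_central F L k = {\<zero>\<^bsub>L\<^esub>})"

definition lie_hom ::
    "('f, 'm) ring_scheme \<Rightarrow> ('f, 'a) lie_alg \<Rightarrow> ('f, 'b) lie_alg \<Rightarrow> ('a \<Rightarrow> 'b) set" where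
  "lie_hom F L M = {f. f \<in> carrier L \<rightarrow> carrier M \<and>
    (\<forall>x\<in>carrier L. \<forall>y\<in>carrier L. f (x \<oplus>\<^bsub>L\<^esub> y) = f x \<oplus>\<^bsub>M\<^esub> f y) \<and>
    (\<forall>a\<in>carrier F. \<forall>x\<in>carrier L. f (a \<odot>\<^bsub>L\<^esub> x) = a \<odot>\<^bsub>M\<^esub> f x) \<and>
    (\<forall>x\<in>carrier L. \<forall>y\<in>carrier L. f (bracket L x y) = bracket M (f x) (f y))}"

definition homomorphic_image ::
    "('f, 'm) ring_scheme \<Rightarrow> ('f, 'a) lie_alg \<Rightarrow> ('f, 'b) lie_alg \<Rightarrow> bool" where
  "homomorphic_image F L M \<longleftrightarrow> lie_algebra F L \<and> lie_algebra F M \<and>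
    (\<exists>f\<in>lie_hom F L M. f ` carrier L = carrier M)"

text \<open>Up to isomorphism, every homomorphic image of a Lie algebra \<open>L\<close> with carrier in a type
  \<open>'a\<close> again has its carrier in \<open>'a\<close>: transport the structure to a set of representatives of
  the fibres. So in the classes below, it is no restriction to let quotients range over the
  Lie algebras with carrier in one fixed type.\<close>

lemma homomorphic_image_same_type:
  fixes L :: "('f, 'a) lie_alg" and M :: "('f, 'b) lie_alg"
  assumes "homomorphic_image F L M"
  obtains N :: "('f, 'a) lie_alg" and h where
    "homomorphic_image F L N" "h \<in> lie_hom F N M" "bij_betw h (carrier N) (carrier M)"
proof -
  from assms obtain f where L: "lie_algebra F L" and M: "lie_algebra F M"
    and f: "f \<in> lie_hom F L M" and surj: "f ` carrier L = carrier M"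
    by (auto simp: homomorphic_image_def)
  interpret M: lie_algebra F M by (rule M)
  define s where "s = inv_into (carrier L) f"
  define N :: "('f, 'a) lie_alg" where
    "N = \<lparr>carrier = s ` carrier M, monoid.mult = undefined, one = undefined, ring.zero = s \<zero>\<^bsub>M\<^esub>,
      add = (\<lambda>x y. s (f x \<oplus>\<^bsub>M\<^esub> f y)), smult = (\<lambda>a x. s (a \<odot>\<^bsub>M\<^esub> f x)),
      bracket = (\<lambda>x y. s (bracket M (f x) (f y)))\<rparr>"
  have N: "carrier N = s ` carrier M" "\<zero>\<^bsub>N\<^esub> = s \<zero>\<^bsub>M\<^esub>"
    "\<And>x y. x \<oplus>\<^bsub>N\<^esub> y = s (f x \<oplus>\<^bsub>M\<^esub> f y)" "\<And>a x. a \<odot>\<^bsub>N\<^esub> x = s (a \<odot>\<^bsub>M\<^esub> f x)"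
    "\<And>x y. bracket N x y = s (bracket M (f x) (f y))"
    by (simp_all add: N_def)
  have fs [simp]: "f (s y) = y" if "y \<in> carrier M" for y
    using that surj by (simp add: s_def f_inv_into_f)
  have fL: "f x \<in> carrier M" if "x \<in> carrier L" for x
    using that surj by blast
  have ab: "abelian_group N"
  proof (rule abelian_groupI)
    fix x assume "x \<in> carrier N"
    then obtain y where y: "y \<in> carrier M" "x = s y" by (auto simp: N)
    then show "\<exists>z\<in>carrier N. z \<oplus>\<^bsub>N\<^esub> x = \<zero>\<^bsub>N\<^esub>"
      by (auto simp: N M.l_neg intro!: bexI[of _ "\<ominus>\<^bsub>M\<^esub> y"])
  qed (auto simp: N M.a_ac)
  have lieN: "lie_algebra F N"
  proof (intro lie_algebra.intro moduleI ab M.field_axioms M.R.is_cring)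
    show "lie_algebra_axioms F N"
      by unfold_locales (auto simp: N M.bracket_add_left M.bracket_add_right
          M.bracket_smult_left M.bracket_smult_right M.bracket_self M.jacobi)
  qed (auto simp: N M.smult_l_distr M.smult_r_distr M.smult_assoc1)
  show thesis
  proof
    have "s \<circ> f \<in> lie_hom F L N"
      using f by (auto simp: lie_hom_def N fL)
    moreover have "(s \<circ> f) ` carrier L = carrier N"
      unfolding image_comp [symmetric] surj N ..
    ultimately show "homomorphic_image F L N"
      using L lieN unfolding homomorphic_image_def by blast
    show "f \<in> lie_hom F N M" by (auto simp: lie_hom_def N)
    show "bij_betw f (carrier N) (carrier M)"
      by (rule bij_betwI[where g = s]) (auto simp: N)
  qed
qed


section \<open>The Baer radical\<close>

definition immediate_predecessor :: "'i rel \<Rightarrow> 'i \<Rightarrow> 'i \<Rightarrow> bool" where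
  "immediate_predecessor r \<beta> \<alpha> \<longleftrightarrow> \<beta> \<in> underS r \<alpha> \<and> (\<forall>\<gamma>\<in>underS r \<alpha>. (\<gamma>, \<beta>) \<in> r)"

text \<open>The well-ordered set \<open>I\<close> is given by its (reflexive) order relation \<open>r\<close>, so that
  \<open>I = Field r\<close> and \<open>underS r \<alpha>\<close> is the set of all \<open>\<beta> < \<alpha>\<close>.\<close>

definition baer_class ::
    "('f, 'm) ring_scheme \<Rightarrow> 'i rel \<Rightarrow> 'i \<Rightarrow> ('f, 'a) lie_alg set" where
  "baer_class F r = wo_rel.worec r (\<lambda>E \<alpha>.
    if underS r \<alpha> = {} then
      {M. \<exists>L :: ('f, 'a) lie_alg. nilpotent_lie_algebra F L \<and> homomorphic_image F L M}
    else if \<exists>\<beta>. immediate_predecessor r \<beta> \<alpha> then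
      {L. lie_algebra F L \<and>
        (\<forall>M :: ('f, 'a) lie_alg. homomorphic_image F L M \<and> nonzero_lie M \<longrightarrow>
          (\<exists>K. lie_ideal F M K \<and> K \<noteq> {\<zero>\<^bsub>M\<^esub>} \<and>
            M\<lparr>carrier := K\<rparr> \<in> E (THE \<beta>. immediate_predecessor r \<beta> \<alpha>)))}
    else (\<Union>\<beta>\<in>underS r \<alpha>. E \<beta>))"

lemma immediate_predecessor_unique:
  assumes "Well_order r" "immediate_predecessor r \<beta> \<alpha>" "immediate_predecessor r \<gamma> \<alpha>"
  shows "\<beta> = \<gamma>"
  using assms unfolding immediate_predecessor_def
  by (metis antisymD well_order_on_def linear_order_on_def partial_order_on_def)

lemma baer_class_rec:
  fixes F :: "('f, 'm) ring_scheme"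
  assumes "Well_order r"
  shows "(baer_class F r \<alpha> :: ('f, 'a) lie_alg set) =
    (if underS r \<alpha> = {} then
      {M. \<exists>L :: ('f, 'a) lie_alg. nilpotent_lie_algebra F L \<and> homomorphic_image F L M}
    else if \<exists>\<beta>. immediate_predecessor r \<beta> \<alpha> then
      {L. lie_algebra F L \<and>
        (\<forall>M :: ('f, 'a) lie_alg. homomorphic_image F L M \<and> nonzero_lie M \<longrightarrow>
          (\<exists>K. lie_ideal F M K \<and> K \<noteq> {\<zero>\<^bsub>M\<^esub>} \<and>
            M\<lparr>carrier := K\<rparr> \<in> baer_class F r (THE \<beta>. immediate_predecessor r \<beta> \<alpha>)))}
    else (\<Union>\<beta>\<in>underS r \<alpha>. baer_class F r \<beta>))"
proof -
  have wo: "wo_rel r" using assms by (simp add: wo_rel_def)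
  have pred: "(THE \<beta>. immediate_predecessor r \<beta> \<alpha>) \<in> underS r \<alpha>"
    if "immediate_predecessor r \<beta> \<alpha>" for \<alpha> \<beta>
  proof -
    have "(THE \<beta>. immediate_predecessor r \<beta> \<alpha>) = \<beta>"
      using that immediate_predecessor_unique[OF assms] by (intro the_equality) auto
    then show ?thesis using that by (simp add: immediate_predecessor_def)
  qed
  show ?thesis
    unfolding baer_class_def
    by (subst wo_rel.worec_fixpoint[OF wo])
      (auto simp: wo_rel.adm_wo_def[OF wo] dest: pred)
qed

text \<open>A Lie algebra is an \<open>r\<^sub>b\<close>-Lie algebra if it lies in some \<open>E\<^sub>I\<close> with \<open>card I > card 2\<^sup>L\<close>.
  HOL has no quantification over the sets of all types, so the type \<open>'i\<close> providing the elements
  of \<open>I\<close> is a parameter: \<open>I\<close> ranges over the subsets of \<open>'i\<close>, and results have to be stated for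
  an arbitrary type \<open>'i\<close> in order to cover every well-ordered set \<open>I\<close>.\<close>

definition rb_lie_algebra ::
    "'i itself \<Rightarrow> ('f, 'm) ring_scheme \<Rightarrow> ('f, 'a) lie_alg \<Rightarrow> bool" where
  "rb_lie_algebra _ F L \<longleftrightarrow> (\<exists>r :: 'i rel.
    Well_order r \<and> (\<exists>\<mu>\<in>Field r. \<forall>\<alpha>\<in>Field r. (\<alpha>, \<mu>) \<in> r) \<and>
    |Pow (carrier L)| <o |Field r| \<and> L \<in> (\<Union>\<alpha>\<in>Field r. baer_class F r \<alpha>))"

definition rb_ideal ::
    "'i itself \<Rightarrow> ('f, 'm) ring_scheme \<Rightarrow> ('f, 'a) lie_alg \<Rightarrow> 'a set \<Rightarrow> bool" where
  "rb_ideal T F L I \<longleftrightarrow> lie_ideal F L I \<and> rb_lie_algebra T F (L\<lparr>carrier := I\<rparr>)"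

definition baer_radical ::
    "'i itself \<Rightarrow> ('f, 'm) ring_scheme \<Rightarrow> ('f, 'a) lie_alg \<Rightarrow> 'a set" where
  "baer_radical T F L = linear_span F L (\<Union>{I. rb_ideal T F L I})"


section \<open>Loop algebras\<close>

text \<open>Since the powers of \<open>t\<close> are a basis of the Laurent polynomials, every element of
  \<open>F[t, t\<^sup>-\<^sup>1] \<otimes> g\<close> is uniquely of the form \<open>\<Sum>n. t\<^sup>n \<otimes> x\<^sub>n\<close> with almost all \<open>x\<^sub>n\<close> zero;
  it is represented by the function \<open>n \<mapsto> x\<^sub>n\<close>.\<close>

definition loop_algebra :: "('f, 'a) lie_alg \<Rightarrow> ('f, int \<Rightarrow> 'a) lie_alg" where
  "loop_algebra g = \<lparr>
    carrier = {u. (\<forall>n. u n \<in> carrier g) \<and> finite {n. u n \<noteq> \<zero>\<^bsub>g\<^esub>}},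
    monoid.mult = undefined, one = undefined,
    ring.zero = (\<lambda>n. \<zero>\<^bsub>g\<^esub>),
    add = (\<lambda>u v n. u n \<oplus>\<^bsub>g\<^esub> v n),
    smult = (\<lambda>a u n. a \<odot>\<^bsub>g\<^esub> u n),
    bracket = (\<lambda>u v n. \<Oplus>\<^bsub>g\<^esub>i\<in>{i. u i \<noteq> \<zero>\<^bsub>g\<^esub>}. bracket g (u i) (v (n - i)))\<rparr>"

text \<open>The element \<open>t\<^sup>m \<otimes> x\<close>.\<close>

definition loop_monom :: "('f, 'a) lie_alg \<Rightarrow> int \<Rightarrow> 'a \<Rightarrow> (int \<Rightarrow> 'a)" where
  "loop_monom g m x = (\<lambda>n. if n = m then x else \<zero>\<^bsub>g\<^esub>)"

lemma loop_simps:
  "carrier (loop_algebra g) = {u. (\<forall>n. u n \<in> carrier g) \<and> finite {n. u n \<noteq> \<zero>\<^bsub>g\<^esub>}}"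
  "\<zero>\<^bsub>loop_algebra g\<^esub> = (\<lambda>n. \<zero>\<^bsub>g\<^esub>)"
  "u \<oplus>\<^bsub>loop_algebra g\<^esub> v = (\<lambda>n. u n \<oplus>\<^bsub>g\<^esub> v n)"
  "a \<odot>\<^bsub>loop_algebra g\<^esub> u = (\<lambda>n. a \<odot>\<^bsub>g\<^esub> u n)"
  by (simp_all add: loop_algebra_def)

context lie_algebra
begin

abbreviation "Lp \<equiv> loop_algebra L"

lemma bracket_zero [simp]:
  assumes "x \<in> carrier L"
  shows "bracket L \<zero>\<^bsub>L\<^esub> x = \<zero>\<^bsub>L\<^esub>" "bracket L x \<zero>\<^bsub>L\<^esub> = \<zero>\<^bsub>L\<^esub>"
  using assms bracket_smult_left[of \<zero> "\<zero>\<^bsub>L\<^esub>" x] bracket_smult_right[of \<zero> x "\<zero>\<^bsub>L\<^esub>"] by auto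

lemma bracket_anti:
  assumes x: "x \<in> carrier L" and y: "y \<in> carrier L"
  shows "bracket L x y \<oplus>\<^bsub>L\<^esub> bracket L y x = \<zero>\<^bsub>L\<^esub>"
proof -
  have "bracket L (x \<oplus>\<^bsub>L\<^esub> y) (x \<oplus>\<^bsub>L\<^esub> y) = bracket L x y \<oplus>\<^bsub>L\<^esub> bracket L y x"
    using x y bracket_self[OF x] bracket_self[OF y]
    by (simp add: bracket_add_left bracket_add_right M.a_comm)
  then show ?thesis using x y by (simp add: bracket_self)
qed

lemma loop_module: "module F Lp"
proof (rule moduleI)
  show "abelian_group Lp"
  proof (rule abelian_groupI)
    fix u v assume u: "u \<in> carrier Lp" and v: "v \<in> carrier Lp"
    have "{n. u n \<oplus>\<^bsub>L\<^esub> v n \<noteq> \<zero>\<^bsub>L\<^esub>} \<subseteq> {n. u n \<noteq> \<zero>\<^bsub>L\<^esub>} \<union> {n. v n \<noteq> \<zero>\<^bsub>L\<^esub>}"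
      by auto
    then show "u \<oplus>\<^bsub>Lp\<^esub> v \<in> carrier Lp"
      using u v by (auto simp: loop_simps intro: finite_subset)
    have "{n. \<ominus>\<^bsub>L\<^esub> u n \<noteq> \<zero>\<^bsub>L\<^esub>} \<subseteq> {n. u n \<noteq> \<zero>\<^bsub>L\<^esub>}" by auto
    then show "\<exists>w\<in>carrier Lp. w \<oplus>\<^bsub>Lp\<^esub> u = \<zero>\<^bsub>Lp\<^esub>"
      using u by (intro bexI[of _ "\<lambda>n. \<ominus>\<^bsub>L\<^esub> u n"])
        (auto simp: loop_simps M.l_neg intro: finite_subset)
  qed (auto simp: loop_simps M.a_ac)
  fix a u assume a: "a \<in> carrier F" and u: "u \<in> carrier Lp"
  have "{n. a \<odot>\<^bsub>L\<^esub> u n \<noteq> \<zero>\<^bsub>L\<^esub>} \<subseteq> {n. u n \<noteq> \<zero>\<^bsub>L\<^esub>}" using a by auto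
  then show "a \<odot>\<^bsub>Lp\<^esub> u \<in> carrier Lp"
    using a u by (auto simp: loop_simps intro: finite_subset)
qed (auto simp: loop_simps smult_l_distr smult_r_distr smult_assoc1 R.is_cring)

lemma loop_bracket_eq:
  assumes u: "u \<in> carrier Lp" and v: "v \<in> carrier Lp"
    and A: "finite A" "{i. u i \<noteq> \<zero>\<^bsub>L\<^esub>} \<subseteq> A"
  shows "bracket Lp u v = (\<lambda>n. \<Oplus>\<^bsub>L\<^esub>i\<in>A. bracket L (u i) (v (n - i)))"
proof
  fix n
  show "bracket Lp u v n = (\<Oplus>\<^bsub>L\<^esub>i\<in>A. bracket L (u i) (v (n - i)))"
    using assms unfolding loop_algebra_def
    by (auto intro!: M.add.finprod_mono_neutral_cong_left simp: loop_simps)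
qed

lemma loop_monom_closed [simp, intro]: "x \<in> carrier L \<Longrightarrow> loop_monom L m x \<in> carrier Lp"
proof -
  assume x: "x \<in> carrier L"
  have "{n. loop_monom L m x n \<noteq> \<zero>\<^bsub>L\<^esub>} \<subseteq> {m}" by (auto simp: loop_monom_def)
  then show ?thesis using x by (auto simp: loop_simps loop_monom_def intro: finite_subset)
qed

lemma loop_bracket_monom:
  assumes x: "x \<in> carrier L" and y: "y \<in> carrier L"
  shows "bracket Lp (loop_monom L m x) (loop_monom L n y) = loop_monom L (m + n) (bracket L x y)"
proof -
  have "bracket Lp (loop_monom L m x) (loop_monom L n y) =
      (\<lambda>k. \<Oplus>\<^bsub>L\<^esub>i\<in>{m}. bracket L (loop_monom L m x i) (loop_monom L n y (k - i)))"
    using x y by (intro loop_bracket_eq loop_monom_closed) (auto simp: loop_monom_def)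
  then show ?thesis
    using x y by (auto simp: loop_monom_def fun_eq_iff)
qed

lemma loop_bracket_closed:
  assumes u: "u \<in> carrier Lp" and v: "v \<in> carrier Lp"
  shows "bracket Lp u v \<in> carrier Lp"
proof -
  let ?A = "{i. u i \<noteq> \<zero>\<^bsub>L\<^esub>}" and ?B = "{i. v i \<noteq> \<zero>\<^bsub>L\<^esub>}"
  have fin: "finite ?A" "finite ?B" using u v by (auto simp: loop_simps)
  have uv: "u i \<in> carrier L" "v i \<in> carrier L" for i using u v by (auto simp: loop_simps)
  have eq: "bracket Lp u v = (\<lambda>n. \<Oplus>\<^bsub>L\<^esub>i\<in>?A. bracket L (u i) (v (n - i)))"
    by (rule loop_bracket_eq[OF u v fin(1) order.refl])
  have "{n. bracket Lp u v n \<noteq> \<zero>\<^bsub>L\<^esub>} \<subseteq> (\<lambda>(i, j). i + j) ` (?A \<times> ?B)"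
  proof
    fix n assume "n \<in> {n. bracket Lp u v n \<noteq> \<zero>\<^bsub>L\<^esub>}"
    then have nz: "(\<Oplus>\<^bsub>L\<^esub>i\<in>?A. bracket L (u i) (v (n - i))) \<noteq> \<zero>\<^bsub>L\<^esub>"
      by (simp add: eq)
    have "\<exists>i\<in>?A. bracket L (u i) (v (n - i)) \<noteq> \<zero>\<^bsub>L\<^esub>"
    proof (rule ccontr)
      assume "\<not> (\<exists>i\<in>?A. bracket L (u i) (v (n - i)) \<noteq> \<zero>\<^bsub>L\<^esub>)"
      then have "(\<Oplus>\<^bsub>L\<^esub>i\<in>?A. bracket L (u i) (v (n - i))) = \<zero>\<^bsub>L\<^esub>"
        by (intro M.add.finprod_one_eqI) blast
      with nz show False ..
    qed
    then obtain i where i: "i \<in> ?A" "bracket L (u i) (v (n - i)) \<noteq> \<zero>\<^bsub>L\<^esub>" by blast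
    moreover have "v (n - i) \<noteq> \<zero>\<^bsub>L\<^esub>" using i(2) bracket_zero(2)[OF uv(1)] by metis
    ultimately show "n \<in> (\<lambda>(i, j). i + j) ` (?A \<times> ?B)"
      by (auto intro!: image_eqI[of _ _ "(i, n - i)"])
  qed
  then have "finite {n. bracket Lp u v n \<noteq> \<zero>\<^bsub>L\<^esub>}"
    by (rule finite_subset) (intro finite_imageI finite_SigmaI fin)
  moreover have "bracket Lp u v n \<in> carrier L" for n
    unfolding eq using uv by (intro M.finsum_closed) auto
  ultimately show ?thesis by (auto simp: loop_simps)
qed

lemma loop_bracket_add:
  assumes u: "u \<in> carrier Lp" and v: "v \<in> carrier Lp" and w: "w \<in> carrier Lp"
  shows "bracket Lp (u \<oplus>\<^bsub>Lp\<^esub> v) w = bracket Lp u w \<oplus>\<^bsub>Lp\<^esub> bracket Lp v w"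
    and "bracket Lp w (u \<oplus>\<^bsub>Lp\<^esub> v) = bracket Lp w u \<oplus>\<^bsub>Lp\<^esub> bracket Lp w v"
proof -
  interpret Lp: module F Lp by (rule loop_module)
  let ?A = "{i. u i \<noteq> \<zero>\<^bsub>L\<^esub>} \<union> {i. v i \<noteq> \<zero>\<^bsub>L\<^esub>} \<union> {i. w i \<noteq> \<zero>\<^bsub>L\<^esub>}"
  have fin: "finite ?A" using u v w by (auto simp: loop_simps)
  have c: "u i \<in> carrier L" "v i \<in> carrier L" "w i \<in> carrier L" for i
    using u v w by (auto simp: loop_simps)
  have uv: "u \<oplus>\<^bsub>Lp\<^esub> v \<in> carrier Lp" using u v by simp
  have sub: "{i. (u \<oplus>\<^bsub>Lp\<^esub> v) i \<noteq> \<zero>\<^bsub>L\<^esub>} \<subseteq> ?A" by (auto simp: loop_simps)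
  have subu: "{i. u i \<noteq> \<zero>\<^bsub>L\<^esub>} \<subseteq> ?A" and subv: "{i. v i \<noteq> \<zero>\<^bsub>L\<^esub>} \<subseteq> ?A"
    and subw: "{i. w i \<noteq> \<zero>\<^bsub>L\<^esub>} \<subseteq> ?A" by auto
  show "bracket Lp (u \<oplus>\<^bsub>Lp\<^esub> v) w = bracket Lp u w \<oplus>\<^bsub>Lp\<^esub> bracket Lp v w"
    unfolding loop_bracket_eq[OF uv w fin sub] loop_bracket_eq[OF u w fin subu]
      loop_bracket_eq[OF v w fin subv]
    unfolding loop_simps
    using c by (simp add: bracket_add_left M.finsum_addf Pi_def)
  show "bracket Lp w (u \<oplus>\<^bsub>Lp\<^esub> v) = bracket Lp w u \<oplus>\<^bsub>Lp\<^esub> bracket Lp w v"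
    unfolding loop_bracket_eq[OF w uv fin subw] loop_bracket_eq[OF w u fin subw]
      loop_bracket_eq[OF w v fin subw]
    unfolding loop_simps
    using c by (simp add: bracket_add_right M.finsum_addf Pi_def)
qed

lemma loop_bracket_smult:
  assumes a: "a \<in> carrier F" and u: "u \<in> carrier Lp" and v: "v \<in> carrier Lp"
  shows "bracket Lp (a \<odot>\<^bsub>Lp\<^esub> u) v = a \<odot>\<^bsub>Lp\<^esub> bracket Lp u v"
    and "bracket Lp u (a \<odot>\<^bsub>Lp\<^esub> v) = a \<odot>\<^bsub>Lp\<^esub> bracket Lp u v"
proof -
  interpret Lp: module F Lp by (rule loop_module)
  let ?A = "{i. u i \<noteq> \<zero>\<^bsub>L\<^esub>}"
  have fin: "finite ?A" using u by (auto simp: loop_simps)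
  have c: "u i \<in> carrier L" "v i \<in> carrier L" for i
    using u v by (auto simp: loop_simps)
  have au: "a \<odot>\<^bsub>Lp\<^esub> u \<in> carrier Lp" and av: "a \<odot>\<^bsub>Lp\<^esub> v \<in> carrier Lp" using a u v by simp_all
  have sub: "{i. (a \<odot>\<^bsub>Lp\<^esub> u) i \<noteq> \<zero>\<^bsub>L\<^esub>} \<subseteq> ?A" using a by (auto simp: loop_simps)
  show "bracket Lp (a \<odot>\<^bsub>Lp\<^esub> u) v = a \<odot>\<^bsub>Lp\<^esub> bracket Lp u v"
    unfolding loop_bracket_eq[OF au v fin sub] loop_bracket_eq[OF u v fin order.refl]
    unfolding loop_simps
    using c a fin by (simp add: bracket_smult_left finsum_smult_ldistr Pi_def)
  show "bracket Lp u (a \<odot>\<^bsub>Lp\<^esub> v) = a \<odot>\<^bsub>Lp\<^esub> bracket Lp u v"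
    unfolding loop_bracket_eq[OF u av fin order.refl] loop_bracket_eq[OF u v fin order.refl]
    unfolding loop_simps
    using c a fin by (simp add: bracket_smult_right finsum_smult_ldistr Pi_def)
qed

lemma loop_induct [consumes 1, case_names monom add]:
  assumes u: "u \<in> carrier Lp"
    and monom: "\<And>m x. x \<in> carrier L \<Longrightarrow> P (loop_monom L m x)"
    and add: "\<And>u v. \<lbrakk>u \<in> carrier Lp; v \<in> carrier Lp; P u; P v\<rbrakk> \<Longrightarrow> P (u \<oplus>\<^bsub>Lp\<^esub> v)"
  shows "P u"
proof -
  have "\<forall>u\<in>carrier Lp. {n. u n \<noteq> \<zero>\<^bsub>L\<^esub>} \<subseteq> A \<longrightarrow> P u" if "finite A" for A
    using that
  proof (induction A)
    case empty
    have "P (loop_monom L 0 \<zero>\<^bsub>L\<^esub>)" by (rule monom) simp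
    moreover have "u = loop_monom L 0 \<zero>\<^bsub>L\<^esub>" if "{n. u n \<noteq> \<zero>\<^bsub>L\<^esub>} \<subseteq> {}" for u
      using that by (auto simp: loop_monom_def)
    ultimately show ?case by metis
  next
    case (insert m A)
    show ?case
    proof (intro ballI impI)
      fix u assume u: "u \<in> carrier Lp" and A: "{n. u n \<noteq> \<zero>\<^bsub>L\<^esub>} \<subseteq> insert m A"
      have um: "u n \<in> carrier L" for n using u by (simp add: loop_simps)
      let ?v = "u(m := \<zero>\<^bsub>L\<^esub>)"
      have sub: "{n. ?v n \<noteq> \<zero>\<^bsub>L\<^esub>} \<subseteq> A" using A by auto
      then have "finite {n. ?v n \<noteq> \<zero>\<^bsub>L\<^esub>}"
        using insert.hyps by (metis finite_subset)
      then have v: "?v \<in> carrier Lp"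
        using um unfolding loop_simps by simp
      have "u = loop_monom L m (u m) \<oplus>\<^bsub>Lp\<^esub> ?v"
        using um by (auto simp: loop_simps loop_monom_def)
      moreover have "P (loop_monom L m (u m) \<oplus>\<^bsub>Lp\<^esub> ?v)"
        using sub v um insert.IH by (intro add monom) auto
      ultimately show "P u" by simp
    qed
  qed
  from this[of "{n. u n \<noteq> \<zero>\<^bsub>L\<^esub>}"] show ?thesis using u by (simp add: loop_simps)
qed

theorem loop_lie_algebra: "lie_algebra F Lp"
proof -
  interpret Lp: module F Lp by (rule loop_module)
  have monom_add: "loop_monom L m x \<oplus>\<^bsub>Lp\<^esub> loop_monom L m y = loop_monom L m (x \<oplus>\<^bsub>L\<^esub> y)"
    if "x \<in> carrier L" "y \<in> carrier L" for m x y
    using that by (auto simp: loop_simps loop_monom_def)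
  have monom_zero: "loop_monom L m \<zero>\<^bsub>L\<^esub> = \<zero>\<^bsub>Lp\<^esub>" for m
    by (auto simp: loop_simps loop_monom_def)
  note [simp] = loop_bracket_closed
  have swap: "(a \<oplus>\<^bsub>Lp\<^esub> b) \<oplus>\<^bsub>Lp\<^esub> (c \<oplus>\<^bsub>Lp\<^esub> d) = (a \<oplus>\<^bsub>Lp\<^esub> c) \<oplus>\<^bsub>Lp\<^esub> (b \<oplus>\<^bsub>Lp\<^esub> d)"
    if "a \<in> carrier Lp" "b \<in> carrier Lp" "c \<in> carrier Lp" "d \<in> carrier Lp" for a b c d
    using that by (simp add: Lp.a_ac)
  have anti: "bracket Lp u v \<oplus>\<^bsub>Lp\<^esub> bracket Lp v u = \<zero>\<^bsub>Lp\<^esub>"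
    if "u \<in> carrier Lp" "v \<in> carrier Lp" for u v
    using that
  proof (induction u rule: loop_induct)
    case (monom m x)
    from monom(2) show ?case
    proof (induction v rule: loop_induct)
      case (monom n y)
      with \<open>x \<in> carrier L\<close> show ?case
        by (simp add: loop_bracket_monom add.commute[of n m] monom_add bracket_anti monom_zero)
    next
      case (add v w)
      with \<open>x \<in> carrier L\<close> show ?case by (simp add: loop_bracket_add swap)
    qed
  next
    case (add u w)
    then show ?case by (simp add: loop_bracket_add swap)
  qed
  have self: "bracket Lp u u = \<zero>\<^bsub>Lp\<^esub>" if "u \<in> carrier Lp" for u
    using that
  proof (induction u rule: loop_induct)
    case (monom m x)
    then show ?case by (simp add: loop_bracket_monom bracket_self monom_zero)
  next
    case (add u v)
    then show ?case using anti[of v u] by (simp add: loop_bracket_add)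
  qed
  have swap3: "(a \<oplus>\<^bsub>Lp\<^esub> a') \<oplus>\<^bsub>Lp\<^esub> (b \<oplus>\<^bsub>Lp\<^esub> b') \<oplus>\<^bsub>Lp\<^esub> (c \<oplus>\<^bsub>Lp\<^esub> c')
      = (a \<oplus>\<^bsub>Lp\<^esub> b \<oplus>\<^bsub>Lp\<^esub> c) \<oplus>\<^bsub>Lp\<^esub> (a' \<oplus>\<^bsub>Lp\<^esub> b' \<oplus>\<^bsub>Lp\<^esub> c')"
    if "a \<in> carrier Lp" "b \<in> carrier Lp" "c \<in> carrier Lp"
      "a' \<in> carrier Lp" "b' \<in> carrier Lp" "c' \<in> carrier Lp" for a b c a' b' c'
    using that by (simp add: Lp.a_ac)
  have jac: "bracket Lp u (bracket Lp v w) \<oplus>\<^bsub>Lp\<^esub> bracket Lp v (bracket Lp w u)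
      \<oplus>\<^bsub>Lp\<^esub> bracket Lp w (bracket Lp u v) = \<zero>\<^bsub>Lp\<^esub>"
    if "u \<in> carrier Lp" "v \<in> carrier Lp" "w \<in> carrier Lp" for u v w
    using that
  proof (induction u rule: loop_induct)
    case (monom m x)
    from monom(2,3) show ?case
    proof (induction v rule: loop_induct)
      case (monom n y)
      from monom(2) show ?case
      proof (induction w rule: loop_induct)
        case (monom k z)
        have exps: "n + (k + m) = m + (n + k)" "k + (m + n) = m + (n + k)" by simp_all
        with monom \<open>x \<in> carrier L\<close> \<open>y \<in> carrier L\<close> show ?case
          by (simp add: loop_bracket_monom exps monom_add jacobi monom_zero)
      next
        case (add w w')
        with \<open>x \<in> carrier L\<close> \<open>y \<in> carrier L\<close> show ?case
          by (simp add: loop_bracket_add swap3)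
      qed
    next
      case (add v v')
      with \<open>x \<in> carrier L\<close> show ?case by (simp add: loop_bracket_add swap3)
    qed
  next
    case (add u u')
    then show ?case by (simp add: loop_bracket_add swap3)
  qed
  show ?thesis
    by (intro lie_algebra.intro lie_algebra_axioms.intro loop_module field_axioms)
      (simp_all add: loop_bracket_add loop_bracket_smult self jac)
qed

end

end

theory Submission
  imports Defs
begin

text \<open>Call \<open>y \<in> g\<close> a stable leading coefficient of \<open>K \<subseteq> L(g)\<close> if for all large \<open>n\<close> the set \<open>K\<close>
  has an element of the form \<open>t\<^sup>n \<otimes> y\<close> plus terms of lower degree. If every \<open>y \<in> g\<close> is one for a
  subalgebra \<open>M\<close>, then those of an ideal \<open>K\<close> of \<open>M\<close> form an ideal of \<open>g\<close>, which is non-zero if \<open>K\<close>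
  is, because \<open>g\<close> has trivial centre; by simplicity it is all of \<open>g\<close>. So the property descends from
  \<open>L(g)\<close> to all its non-zero subideals. It also passes along the lower central series, so none of
  these subideals is nilpotent. On the other hand, a non-zero member of a class \<open>E\<^sub>\<alpha>\<close> has a non-zero
  nilpotent subideal, by induction on \<open>\<alpha>\<close>.\<close>

section \<open>Submodules and linear spans\<close>

lemma submodule_zero: "submodule K F M \<Longrightarrow> \<zero>\<^bsub>M\<^esub> \<in> K"
  using subgroup.one_closed[OF submodule.axioms(1), of K F M] by simp

lemma submodule_add:
  "\<lbrakk>submodule K F M; x \<in> K; y \<in> K\<rbrakk> \<Longrightarrow> x \<oplus>\<^bsub>M\<^esub> y \<in> K"
  using subgroup.m_closed[OF submodule.axioms(1), of K F M x y] by simp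

lemma submodule_subset: "submodule K F M \<Longrightarrow> K \<subseteq> carrier M"
  using subgroup.subset[OF submodule.axioms(1), of K F M] by simp

text \<open>Negatives are multiples by minus one, so closure under them follows from closure under
  scalars.\<close>

lemma (in module) submoduleI_smult:
  assumes "K \<subseteq> carrier M" "\<zero>\<^bsub>M\<^esub> \<in> K" "\<And>x y. \<lbrakk>x \<in> K; y \<in> K\<rbrakk> \<Longrightarrow> x \<oplus>\<^bsub>M\<^esub> y \<in> K"
    and smult: "\<And>a x. \<lbrakk>a \<in> carrier R; x \<in> K\<rbrakk> \<Longrightarrow> a \<odot>\<^bsub>M\<^esub> x \<in> K"
  shows "submodule K R M"
proof (rule submoduleI)
  fix x assume x: "x \<in> K"
  then have "\<ominus>\<^bsub>M\<^esub> x = (\<ominus> \<one>) \<odot>\<^bsub>M\<^esub> x"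
    using assms(1) by (auto simp: smult_l_minus)
  then show "\<ominus>\<^bsub>M\<^esub> x \<in> K" using x by (simp add: smult)
qed (use assms in auto)

lemma linear_span_superset: "S \<subseteq> linear_span F M S"
  by (auto simp: linear_span_def)

lemma linear_span_minimal: "\<lbrakk>submodule N F M; S \<subseteq> N\<rbrakk> \<Longrightarrow> linear_span F M S \<subseteq> N"
  by (auto simp: linear_span_def)

lemma linear_span_submodule:
  assumes "module F M" "S \<subseteq> carrier M"
  shows "submodule (linear_span F M S) F M"
proof -
  interpret module F M by (rule assms(1))
  show ?thesis
  proof (rule submoduleI_smult)
    show "linear_span F M S \<subseteq> carrier M"
      by (rule linear_span_minimal[OF carrier_is_submodule assms(2)])
  qed (auto simp: linear_span_def submodule_zero submodule_add submodule.smult_closed)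
qed

lemma linear_span_subset_zero:
  assumes "module F M" "S \<subseteq> {\<zero>\<^bsub>M\<^esub>}"
  shows "linear_span F M S = {\<zero>\<^bsub>M\<^esub>}"
proof -
  interpret module F M by (rule assms(1))
  have "submodule {\<zero>\<^bsub>M\<^esub>} F M" by (rule submoduleI_smult) auto
  then have "linear_span F M S \<subseteq> {\<zero>\<^bsub>M\<^esub>}" using assms(2) by (rule linear_span_minimal)
  moreover have "\<zero>\<^bsub>M\<^esub> \<in> linear_span F M S" by (auto simp: linear_span_def submodule_zero)
  ultimately show ?thesis by blast
qed

section \<open>Lower central series and homomorphic images\<close>

lemma (in lie_algebra) lower_central_submodule: "submodule (lower_central F L k) F L"
proof (induction k)
  case 0
  show ?case by (simp add: carrier_is_submodule)
next
  case (Suc k)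
  then have "lower_central F L k \<subseteq> carrier L" by (rule submodule_subset)
  then show ?case
    by (auto intro!: linear_span_submodule module_axioms)
qed

text \<open>By induction on \<open>k\<close>, the image of the \<open>k\<close>-th term of the lower
  central series of \<open>L\<close> contains that of \<open>M\<close>. This settles the least
  class, which consists of images of nilpotent algebras.\<close>

lemma nilpotent_homomorphic_image:
  assumes nil: "nilpotent_lie_algebra F L" and hom: "homomorphic_image F L M"
  shows "nilpotent_lie_algebra F M"
proof -
  from hom obtain f where f: "f \<in> lie_hom F L M" and surj: "f ` carrier L = carrier M"
    and lie: "lie_algebra F L" "lie_algebra F M"
    by (auto simp: homomorphic_image_def)
  interpret L: lie_algebra F L by (rule lie)
  interpret M: lie_algebra F M by (rule lie)
  have fc: "f x \<in> carrier M" if "x \<in> carrier L" for x using surj that by blast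
  have f0: "f \<zero>\<^bsub>L\<^esub> = \<zero>\<^bsub>M\<^esub>"
  proof -
    \<comment> \<open>\<open>lie_hom\<close> does not mention zero; its preservation comes from the
      scalar zero.\<close>
    have "f (\<zero>\<^bsub>F\<^esub> \<odot>\<^bsub>L\<^esub> \<zero>\<^bsub>L\<^esub>) = \<zero>\<^bsub>F\<^esub> \<odot>\<^bsub>M\<^esub> f \<zero>\<^bsub>L\<^esub>"
      using f L.M.zero_closed L.R.zero_closed unfolding lie_hom_def by blast
    then show ?thesis by (simp add: fc)
  qed
  have img: "submodule (f ` N) F M" if N: "submodule N F L" for N
  proof (rule M.submoduleI_smult)
    note NL = submodule_subset[OF N]
    show "f ` N \<subseteq> carrier M" using NL fc by blast
    show "\<zero>\<^bsub>M\<^esub> \<in> f ` N" using submodule_zero[OF N] f0 by (metis imageI)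
    fix x y assume "x \<in> f ` N" "y \<in> f ` N"
    then obtain x' y' where xy: "x' \<in> N" "y' \<in> N" "x = f x'" "y = f y'" by blast
    then have "x \<oplus>\<^bsub>M\<^esub> y = f (x' \<oplus>\<^bsub>L\<^esub> y')"
      using f subsetD[OF NL xy(1)] subsetD[OF NL xy(2)] by (simp add: lie_hom_def)
    then show "x \<oplus>\<^bsub>M\<^esub> y \<in> f ` N" using submodule_add[OF N] xy by blast
  next
    note NL = submodule_subset[OF N]
    fix a x assume a: "a \<in> carrier F" and "x \<in> f ` N"
    then obtain x' where x: "x' \<in> N" "x = f x'" by blast
    then have "a \<odot>\<^bsub>M\<^esub> x = f (a \<odot>\<^bsub>L\<^esub> x')" using f NL a by (auto simp: lie_hom_def)
    then show "a \<odot>\<^bsub>M\<^esub> x \<in> f ` N" using submodule.smult_closed[OF N a] x by blast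
  qed
  have sub: "lower_central F M k \<subseteq> f ` lower_central F L k" for k
  proof (induction k)
    case 0
    show ?case by (simp add: surj)
  next
    case (Suc k)
    have "{bracket M x y |x y. x \<in> carrier M \<and> y \<in> lower_central F M k}
        \<subseteq> f ` lower_central F L (Suc k)"
    proof clarify
      fix x y assume "x \<in> carrier M" "y \<in> lower_central F M k"
      then obtain x' y' where xy: "x' \<in> carrier L" "y' \<in> lower_central F L k" "x = f x'" "y = f y'"
        using Suc surj by blast
      then have "bracket M x y = f (bracket L x' y')"
        using f submodule_subset[OF L.lower_central_submodule, of k] by (auto simp: lie_hom_def)
      moreover have "bracket L x' y' \<in> lower_central F L (Suc k)"
        using xy by (auto intro!: subsetD[OF linear_span_superset])
      ultimately show "bracket M x y \<in> f ` lower_central F L (Suc k)" by blast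
    qed
    then show ?case
      using linear_span_minimal[OF img[OF L.lower_central_submodule[of "Suc k"]]] by simp
  qed
  from nil obtain k where "lower_central F L k = {\<zero>\<^bsub>L\<^esub>}"
    by (auto simp: nilpotent_lie_algebra_def)
  then have "lower_central F M k \<subseteq> {\<zero>\<^bsub>M\<^esub>}" using sub[of k] f0 by simp
  then have "lower_central F M k = {\<zero>\<^bsub>M\<^esub>}"
    using submodule_zero[OF M.lower_central_submodule[of k]] by blast
  then show ?thesis using lie by (auto simp: nilpotent_lie_algebra_def)
qed

text \<open>Lets the condition on all non-zero images in a successor class be applied to the algebra
  itself.\<close>

lemma (in lie_algebra) homomorphic_image_refl: "homomorphic_image F L L"
  unfolding homomorphic_image_def
  by (auto intro!: bexI[of _ "\<lambda>x. x"] lie_algebra_axioms simp: lie_hom_def)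

section \<open>Ideals and centre of a simple Lie algebra\<close>

lemma (in lie_algebra) simple_ideal_eq_carrier:
  assumes "simple_lie_algebra F L" "lie_ideal F L I" "x \<in> I" "x \<noteq> \<zero>\<^bsub>L\<^esub>"
  shows "I = carrier L"
  using assms by (auto simp: simple_lie_algebra_def)

text \<open>The centre \<open>Z\<close> is an ideal. If it contained \<open>x\<close>, it would be
  everything by simplicity, and all brackets would vanish.\<close>

lemma (in lie_algebra) simple_trivial_center:
  assumes simple: "simple_lie_algebra F L" and x: "x \<in> carrier L" "x \<noteq> \<zero>\<^bsub>L\<^esub>"
  obtains z where "z \<in> carrier L" "bracket L z x \<noteq> \<zero>\<^bsub>L\<^esub>"
proof (rule ccontr)
  assume "\<not> thesis"
  define Z where "Z = {y \<in> carrier L. \<forall>z\<in>carrier L. bracket L z y = \<zero>\<^bsub>L\<^esub>}"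
  have "submodule Z F L"
    by (rule submoduleI_smult) (auto simp: Z_def bracket_add_right bracket_smult_right)
  then have "lie_ideal F L Z" by (auto simp: lie_ideal_def Z_def)
  moreover have "x \<in> Z" using x that \<open>\<not> thesis\<close> by (auto simp: Z_def)
  ultimately have "Z = carrier L" using simple x(2) simple_ideal_eq_carrier by blast
  then show False using simple by (auto simp: simple_lie_algebra_def Z_def)
qed

section \<open>Stable leading coefficients in the loop algebra\<close>

context lie_algebra
begin

text \<open>Asking for all large \<open>n\<close> lets two coefficients be realised in one common
  degree, which gives closure under sums. The value \<open>y\<close> may be zero, so
  \<open>n\<close> only bounds the degree of \<open>u\<close>.\<close>

definition stable_lead :: "(int \<Rightarrow> 'a) set \<Rightarrow> 'a set" where
  "stable_lead K = {y \<in> carrier L. \<exists>N. \<forall>n\<ge>N. \<exists>u\<in>K. u n = y \<and> (\<forall>k>n. u k = \<zero>\<^bsub>L\<^esub>)}"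

lemma stable_leadI:
  assumes "y \<in> carrier L" "\<And>n. n \<ge> N \<Longrightarrow> \<exists>u\<in>K. u n = y \<and> (\<forall>k>n. u k = \<zero>\<^bsub>L\<^esub>)"
  shows "y \<in> stable_lead K"
  using assms by (auto simp: stable_lead_def)

lemma stable_leadE:
  assumes "y \<in> stable_lead K"
  obtains N where "y \<in> carrier L" "\<And>n. n \<ge> N \<Longrightarrow> \<exists>u\<in>K. u n = y \<and> (\<forall>k>n. u k = \<zero>\<^bsub>L\<^esub>)"
  using assms by (auto simp: stable_lead_def)

lemma stable_lead_carrier: "stable_lead (carrier Lp) = carrier L"
proof
  show "carrier L \<subseteq> stable_lead (carrier Lp)"
  proof
    fix y assume y: "y \<in> carrier L"
    show "y \<in> stable_lead (carrier Lp)"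
      by (rule stable_leadI[OF y, where N = 0], rule bexI[OF _ loop_monom_closed[OF y]])
        (auto simp: loop_monom_def)
  qed
qed (auto simp: stable_lead_def)

text \<open>The carrier is replaced by some \<open>M\<close> because \<open>K\<close> will be an
  ideal of a subalgebra, or a term of its lower central series; the operations are those of
  \<open>Lp\<close> in either case.\<close>

lemma stable_lead_submodule:
  assumes K: "submodule K F (Lp\<lparr>carrier := M\<rparr>)"
  shows "submodule (stable_lead K) F L"
proof (rule submoduleI_smult)
  show "stable_lead K \<subseteq> carrier L" by (auto simp: stable_lead_def)
  show "\<zero>\<^bsub>L\<^esub> \<in> stable_lead K"
    using submodule_zero[OF K] by (auto intro!: stable_leadI simp: loop_simps)
next
  fix x y assume "x \<in> stable_lead K" "y \<in> stable_lead K"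
  then obtain N N' where N: "x \<in> carrier L" "y \<in> carrier L"
    "\<And>n. n \<ge> N \<Longrightarrow> \<exists>u\<in>K. u n = x \<and> (\<forall>k>n. u k = \<zero>\<^bsub>L\<^esub>)"
    "\<And>n. n \<ge> N' \<Longrightarrow> \<exists>u\<in>K. u n = y \<and> (\<forall>k>n. u k = \<zero>\<^bsub>L\<^esub>)"
    by (auto elim!: stable_leadE)
  show "x \<oplus>\<^bsub>L\<^esub> y \<in> stable_lead K"
  proof (rule stable_leadI)
    fix n assume n: "n \<ge> max N N'"
    obtain u v where uv: "u \<in> K" "v \<in> K" "u n = x" "v n = y"
      "\<forall>k>n. u k = \<zero>\<^bsub>L\<^esub>" "\<forall>k>n. v k = \<zero>\<^bsub>L\<^esub>"
      using N(3)[of n] N(4)[of n] n by auto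
    then show "\<exists>w\<in>K. w n = x \<oplus>\<^bsub>L\<^esub> y \<and> (\<forall>k>n. w k = \<zero>\<^bsub>L\<^esub>)"
      using submodule_add[OF K uv(1,2)] by (auto simp: loop_simps intro: bexI[of _ "\<lambda>n. u n \<oplus>\<^bsub>L\<^esub> v n"])
  qed (use N in auto)
next
  fix a x assume a: "a \<in> carrier F" and "x \<in> stable_lead K"
  then obtain N where N: "x \<in> carrier L"
    "\<And>n. n \<ge> N \<Longrightarrow> \<exists>u\<in>K. u n = x \<and> (\<forall>k>n. u k = \<zero>\<^bsub>L\<^esub>)"
    by (auto elim!: stable_leadE)
  show "a \<odot>\<^bsub>L\<^esub> x \<in> stable_lead K"
  proof (rule stable_leadI)
    fix n assume n: "n \<ge> N"
    obtain u where u: "u \<in> K" "u n = x" "\<forall>k>n. u k = \<zero>\<^bsub>L\<^esub>"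
      using N(2)[of n] n by auto
    then show "\<exists>w\<in>K. w n = a \<odot>\<^bsub>L\<^esub> x \<and> (\<forall>k>n. w k = \<zero>\<^bsub>L\<^esub>)"
      using submodule.smult_closed[OF K a u(1)] a by (auto simp: loop_simps intro: bexI[of _ "\<lambda>n. a \<odot>\<^bsub>L\<^esub> u n"])
  qed (use N a in auto)
qed

text \<open>In degree \<open>m + n\<close> only the index \<open>i = m\<close> contributes:
  \<open>u i\<close> vanishes for \<open>i > m\<close>, and \<open>v (m + n - i)\<close> for
  \<open>i < m\<close>. In higher degrees no index is left.\<close>

lemma loop_bracket_lead:
  assumes u: "u \<in> carrier Lp" and v: "v \<in> carrier Lp"
    and um: "\<forall>k>m. u k = \<zero>\<^bsub>L\<^esub>" and vn: "\<forall>k>n. v k = \<zero>\<^bsub>L\<^esub>"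
  shows "bracket Lp u v (m + n) = bracket L (u m) (v n)"
    and "k > m + n \<Longrightarrow> bracket Lp u v k = \<zero>\<^bsub>L\<^esub>"
proof -
  \<comment> \<open>\<open>u m\<close> may be zero, but the sum is to be collapsed to the index
    \<open>m\<close>, which must therefore belong to the index set.\<close>
  let ?A = "insert m {i. u i \<noteq> \<zero>\<^bsub>L\<^esub>}"
  have fin: "finite ?A" using u by (simp add: loop_simps)
  have c: "u i \<in> carrier L" "v i \<in> carrier L" for i using u v by (auto simp: loop_simps)
  have eq: "bracket Lp u v = (\<lambda>n. \<Oplus>\<^bsub>L\<^esub>i\<in>?A. bracket L (u i) (v (n - i)))"
    by (rule loop_bracket_eq[OF u v fin]) auto
  have "bracket L (u i) (v (m + n - i)) = \<zero>\<^bsub>L\<^esub>" if "i \<noteq> m" for i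
  proof (cases "i > m")
    case True
    then show ?thesis using um c by simp
  next
    case False
    then show ?thesis using vn c that by simp
  qed
  then have "(\<Oplus>\<^bsub>L\<^esub>i\<in>?A. bracket L (u i) (v (m + n - i)))
      = (\<Oplus>\<^bsub>L\<^esub>i\<in>?A. if m = i then bracket L (u i) (v (m + n - i)) else \<zero>\<^bsub>L\<^esub>)"
    using c by (intro M.finsum_cong') auto
  also have "\<dots> = bracket L (u m) (v n)"
    using c by (subst M.finsum_singleton[OF _ fin]) auto
  finally show "bracket Lp u v (m + n) = bracket L (u m) (v n)" by (simp add: eq)
  assume k: "k > m + n"
  have "bracket L (u i) (v (k - i)) = \<zero>\<^bsub>L\<^esub>" for i
  proof (cases "i > m")
    case True
    then show ?thesis using um c by simp
  next
    case False
    then show ?thesis using vn c k by simp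
  qed
  then show "bracket Lp u v k = \<zero>\<^bsub>L\<^esub>" by (simp add: eq)
qed

text \<open>A single \<open>v\<close> is enough, as stability is supplied by \<open>M\<close>:
  elements of \<open>M\<close> with coefficient \<open>z\<close> in degree \<open>n - d\<close>,
  bracketed with \<open>v\<close>, serve every \<open>n\<close> from \<open>N + d\<close> on.
  \<open>K\<close> has to absorb brackets with this \<open>v\<close> only, so the lemma fits both
  ideals and lower central terms.\<close>

lemma stable_lead_bracket:
  assumes M: "M \<subseteq> carrier Lp" and z: "z \<in> stable_lead M"
    and v: "v \<in> carrier Lp" "\<forall>k>d. v k = \<zero>\<^bsub>L\<^esub>"
    and K: "\<And>u. u \<in> M \<Longrightarrow> bracket Lp u v \<in> K"
  shows "bracket L z (v d) \<in> stable_lead K"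
proof -
  from z obtain N where zc: "z \<in> carrier L"
    and N: "\<And>n. n \<ge> N \<Longrightarrow> \<exists>u\<in>M. u n = z \<and> (\<forall>k>n. u k = \<zero>\<^bsub>L\<^esub>)"
    by (rule stable_leadE) (rule that)
  show ?thesis
  proof (rule stable_leadI)
    show "bracket L z (v d) \<in> carrier L" using zc v by (auto simp: loop_simps)
    fix n assume "n \<ge> N + d"
    then obtain u where u: "u \<in> M" "u (n - d) = z" "\<forall>k>n - d. u k = \<zero>\<^bsub>L\<^esub>"
      using N[of "n - d"] by auto
    then have "bracket Lp u v n = bracket L z (v d)" "\<forall>k>n. bracket Lp u v k = \<zero>\<^bsub>L\<^esub>"
      using loop_bracket_lead[of u v "n - d" d] M v by auto
    with K[OF u(1)] show "\<exists>u\<in>K. u n = bracket L z (v d) \<and> (\<forall>k>n. u k = \<zero>\<^bsub>L\<^esub>)" by blast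
  qed
qed

text \<open>The step from a subalgebra to its ideals. Any element of \<open>carrier L\<close> is
  stable for \<open>M\<close>, so it can play the role of \<open>z\<close> in
  \<open>stable_lead_bracket\<close>; this gives both the ideal property and a non-zero
  member.\<close>

lemma stable_lead_ideal:
  assumes simple: "simple_lie_algebra F L"
    and M: "M \<subseteq> carrier Lp" "stable_lead M = carrier L"
    and K: "lie_ideal F (Lp\<lparr>carrier := M\<rparr>) K" "K \<noteq> {\<zero>\<^bsub>Lp\<^esub>}"
  shows "stable_lead K = carrier L"
proof -
  have sub: "submodule K F (Lp\<lparr>carrier := M\<rparr>)"
    and MK: "\<And>u v. \<lbrakk>u \<in> M; v \<in> K\<rbrakk> \<Longrightarrow> bracket Lp u v \<in> K"
    using K(1) by (auto simp: lie_ideal_def)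
  have KLp: "K \<subseteq> carrier Lp" using submodule_subset[OF sub] M(1) by auto
  have "bracket L z y \<in> stable_lead K" if z: "z \<in> carrier L" and y: "y \<in> stable_lead K" for z y
  proof -
    from y obtain n v where v: "v \<in> K" "v n = y" "\<forall>k>n. v k = \<zero>\<^bsub>L\<^esub>"
      by (meson stable_leadE order.refl)
    show ?thesis
      using stable_lead_bracket[OF M(1) _ _ v(3), of z K] v(1,2) z M(2) KLp MK by auto
  qed
  then have ideal: "lie_ideal F L (stable_lead K)"
    using stable_lead_submodule[OF sub] by (auto simp: lie_ideal_def)
  obtain v where v: "v \<in> K" "v \<noteq> \<zero>\<^bsub>Lp\<^esub>" using K(2) submodule_zero[OF sub] by auto
  then have vc: "v \<in> carrier Lp" using KLp by blast
  \<comment> \<open>The top degree of \<open>v\<close>. The coefficient \<open>v d\<close> is not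
    yet known to be stable for \<open>K\<close>, but its bracket with a suitable \<open>z\<close>
    is, and is non-zero.\<close>
  define d where "d = Max {i. v i \<noteq> \<zero>\<^bsub>L\<^esub>}"
  have fin: "finite {i. v i \<noteq> \<zero>\<^bsub>L\<^esub>}" using vc by (simp add: loop_simps)
  have ne: "{i. v i \<noteq> \<zero>\<^bsub>L\<^esub>} \<noteq> {}" using v(2) by (auto simp: loop_simps)
  have d: "v d \<noteq> \<zero>\<^bsub>L\<^esub>" using Max_in[OF fin ne] by (simp add: d_def)
  have dk: "\<forall>k>d. v k = \<zero>\<^bsub>L\<^esub>" using Max_ge[OF fin] by (force simp: d_def)
  have "v d \<in> carrier L" using vc by (simp add: loop_simps)
  then obtain z where z: "z \<in> carrier L" "bracket L z (v d) \<noteq> \<zero>\<^bsub>L\<^esub>"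
    using d by (rule simple_trivial_center[OF simple])
  have "bracket L z (v d) \<in> stable_lead K"
    using z(1) M(2) MK v(1) by (intro stable_lead_bracket[OF M(1) _ vc dk]) auto
  then show ?thesis using simple ideal z(2) simple_ideal_eq_carrier by blast
qed

section \<open>Incompatibility with nilpotency and with the Baer classes\<close>

lemma stable_lead_nonzero:
  assumes simple: "simple_lie_algebra F L" and K: "stable_lead K = carrier L"
  shows "K \<noteq> {\<zero>\<^bsub>Lp\<^esub>}"
proof
  assume 0: "K = {\<zero>\<^bsub>Lp\<^esub>}"
  have "y = \<zero>\<^bsub>L\<^esub>" if "y \<in> carrier L" for y
  proof -
    from that K have "y \<in> stable_lead K" by simp
    then obtain n u where "u \<in> K" "u n = y" by (meson stable_leadE order.refl)
    then show ?thesis using 0 by (auto simp: loop_simps)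
  qed
  then show False using simple bracket_closed by (fastforce simp: simple_lie_algebra_def)
qed

text \<open>No term of the lower central series loses a stable coefficient, so none is zero. That
  \<open>M\<close> is a subalgebra comes from the nilpotency being refuted.\<close>

lemma stable_lead_not_nilpotent:
  assumes simple: "simple_lie_algebra F L"
    and M: "M \<subseteq> carrier Lp" "stable_lead M = carrier L"
  shows "\<not> nilpotent_lie_algebra F (Lp\<lparr>carrier := M\<rparr>)"
proof
  let ?M = "Lp\<lparr>carrier := M\<rparr>"
  assume nil: "nilpotent_lie_algebra F ?M"
  then interpret M: lie_algebra F ?M by (simp add: nilpotent_lie_algebra_def)
  obtain x y where xy: "x \<in> carrier L" "y \<in> carrier L" "bracket L x y \<noteq> \<zero>\<^bsub>L\<^esub>"
    using simple by (auto simp: simple_lie_algebra_def)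
  have lead: "stable_lead (lower_central F ?M k) = carrier L" for k
  proof (induction k)
    case 0
    show ?case by (simp add: M)
  next
    case (Suc k)
    let ?C = "lower_central F ?M"
    have sub: "submodule (?C j) F ?M" for j by (rule M.lower_central_submodule)
    \<comment> \<open>Here \<open>w\<close> ranges over all of \<open>carrier L\<close>, so
      \<open>br\<close> yields the ideal property and, as \<open>L\<close> is not abelian, a
      non-zero member.\<close>
    have br: "bracket L z w \<in> stable_lead (?C (Suc k))" if z: "z \<in> carrier L" and w: "w \<in> carrier L"
      for z w
    proof -
      from w Suc obtain n v where v: "v \<in> ?C k" "v n = w" "\<forall>k>n. v k = \<zero>\<^bsub>L\<^esub>"
        by (metis stable_leadE order.refl)
      have "bracket ?M u v \<in> ?C (Suc k)" if "u \<in> M" for u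
        using that v(1) by (auto intro!: subsetD[OF linear_span_superset])
      moreover have "v \<in> carrier Lp" using submodule_subset[OF sub, of k] v(1) M(1) by auto
      ultimately have "bracket L z (v n) \<in> stable_lead (?C (Suc k))"
        using z M(2) v(3) by (intro stable_lead_bracket[OF M(1)]) auto
      then show ?thesis by (simp only: v(2))
    qed
    have "stable_lead (?C (Suc k)) \<subseteq> carrier L"
      by (rule submodule_subset[OF stable_lead_submodule[OF sub]])
    then have "lie_ideal F L (stable_lead (?C (Suc k)))"
      using stable_lead_submodule[OF sub] br unfolding lie_ideal_def by blast
    with br[OF xy(1,2)] show ?case using simple_ideal_eq_carrier[OF simple] xy(3) by blast
  qed
  from nil obtain k where "lower_central F ?M k = {\<zero>\<^bsub>Lp\<^esub>}"
    by (auto simp: nilpotent_lie_algebra_def)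
  then show False using stable_lead_nonzero[OF simple lead] by blast
qed

text \<open>One induction on \<open>\<alpha>\<close> combines the descent to subideals with the
  invariance of the property. \<open>M\<close> is generalised because in the successor case an ideal
  \<open>K\<close> of \<open>M\<close> takes its place; in the limit case only
  \<open>\<alpha>\<close> drops.\<close>

lemma stable_lead_not_baer_class:
  fixes r :: "'i rel"
  assumes simple: "simple_lie_algebra F L" and r: "Well_order r"
    and M: "M \<subseteq> carrier Lp" "stable_lead M = carrier L"
  shows "Lp\<lparr>carrier := M\<rparr> \<notin> baer_class F r \<alpha>"
  using M
proof (induction \<alpha> arbitrary: M rule: wo_rel.well_order_induct[of r])
  case 1
  show ?case using r by (simp add: wo_rel_def)
next
  case (2 \<alpha>)
  let ?M = "Lp\<lparr>carrier := M\<rparr>"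
  have IH: "Lp\<lparr>carrier := K\<rparr> \<notin> baer_class F r \<beta>"
    if "\<beta> \<in> underS r \<alpha>" "K \<subseteq> carrier Lp" "stable_lead K = carrier L" for \<beta> K
    using 2(1) that by (auto simp: underS_def)
  show ?case
  proof
    assume E: "?M \<in> baer_class F r \<alpha>"
    consider "underS r \<alpha> = {}" | \<beta> where "underS r \<alpha> \<noteq> {}" "immediate_predecessor r \<beta> \<alpha>"
      | "underS r \<alpha> \<noteq> {}" "\<not> (\<exists>\<beta>. immediate_predecessor r \<beta> \<alpha>)" by blast
    then show False
    proof cases
      case 1
      with E have "\<exists>N :: ('f, int \<Rightarrow> 'a) lie_alg. nilpotent_lie_algebra F N \<and> homomorphic_image F N ?M"
        by (simp add: baer_class_rec[OF r, of F \<alpha>])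
      then show False
        using nilpotent_homomorphic_image stable_lead_not_nilpotent[OF simple 2(2,3)] by blast
    next
      case (2 \<beta>)
      have the: "(THE \<beta>. immediate_predecessor r \<beta> \<alpha>) = \<beta>"
        using 2(2) immediate_predecessor_unique[OF r] by blast
      have ex: "\<exists>\<beta>. immediate_predecessor r \<beta> \<alpha>" using 2(2) by blast
      from E have lie: "lie_algebra F ?M"
        and K: "\<And>N :: ('f, int \<Rightarrow> 'a) lie_alg. \<lbrakk>homomorphic_image F ?M N; nonzero_lie N\<rbrakk> \<Longrightarrow>
          \<exists>K. lie_ideal F N K \<and> K \<noteq> {\<zero>\<^bsub>N\<^esub>} \<and> N\<lparr>carrier := K\<rparr> \<in> baer_class F r \<beta>"
        unfolding baer_class_rec[OF r, of F \<alpha>] if_not_P[OF 2(1)] if_P[OF ex] the by blast+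
      have "nonzero_lie ?M"
        using stable_lead_nonzero[OF simple \<open>stable_lead M = carrier L\<close>]
        by (simp add: nonzero_lie_def)
      \<comment> \<open>The image chosen is \<open>?M\<close> itself. Replacing its carrier by
        \<open>K\<close> gives \<open>Lp\<close> with carrier \<open>K\<close>, so subideals keep
        the shape required by \<open>IH\<close>.\<close>
      with K[OF lie_algebra.homomorphic_image_refl[OF lie]] obtain K where
        K: "lie_ideal F ?M K" "K \<noteq> {\<zero>\<^bsub>Lp\<^esub>}" "Lp\<lparr>carrier := K\<rparr> \<in> baer_class F r \<beta>"
        by auto
      have "K \<subseteq> carrier Lp"
        using K(1) submodule_subset[of K F ?M] \<open>M \<subseteq> carrier Lp\<close> by (auto simp: lie_ideal_def)
      moreover have "stable_lead K = carrier L"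
        using stable_lead_ideal[OF simple _ _ K(1,2)] \<open>M \<subseteq> carrier Lp\<close> \<open>stable_lead M = carrier L\<close>
        by blast
      moreover have "\<beta> \<in> underS r \<alpha>" using 2(2) by (simp add: immediate_predecessor_def)
      ultimately show False using IH K(3) by blast
    next
      case 3
      with E show False using IH 2(2,3) by (auto simp: baer_class_rec[OF r, of F \<alpha>])
    qed
  qed
qed

section \<open>The Baer radical of the loop algebra\<close>

lemma loop_rb_ideal_zero:
  assumes simple: "simple_lie_algebra F L" and I: "rb_ideal TYPE('i) F Lp I"
  shows "I = {\<zero>\<^bsub>Lp\<^esub>}"
proof (rule ccontr)
  assume nz: "I \<noteq> {\<zero>\<^bsub>Lp\<^esub>}"
  have ideal: "lie_ideal F Lp I" using I by (simp add: rb_ideal_def)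
  obtain r :: "'i rel" and \<alpha> where r: "Well_order r" "Lp\<lparr>carrier := I\<rparr> \<in> baer_class F r \<alpha>"
    using I by (auto simp: rb_ideal_def rb_lie_algebra_def)
  \<comment> \<open>The void update brings \<open>Lp\<close> into the shape of
    \<open>stable_lead_ideal\<close>, with \<open>M\<close> the whole loop algebra.\<close>
  have "lie_ideal F (Lp\<lparr>carrier := carrier Lp\<rparr>) I" using ideal by simp
  then have "stable_lead I = carrier L"
    using stable_lead_ideal[OF simple order.refl stable_lead_carrier] nz by blast
  moreover have "I \<subseteq> carrier Lp" using ideal submodule_subset by (auto simp: lie_ideal_def)
  ultimately show False using stable_lead_not_baer_class[OF simple r(1)] r(2) by blast
qed

end

theorem proposition6p8:
  fixes F :: "('f, 'm) ring_scheme" and g :: "('f, 'g) lie_alg"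
  assumes "algebraically_closed F"
    and "\<forall>n::nat. n > 0 \<longrightarrow> [n] \<cdot>\<^bsub>F\<^esub> \<one>\<^bsub>F\<^esub> \<noteq> \<zero>\<^bsub>F\<^esub>"
    and "simple_lie_algebra F g"
    and "finite_dimensional F g"
  shows "baer_radical TYPE('i) F (loop_algebra g) = {\<zero>\<^bsub>loop_algebra g\<^esub>}"
proof -
  interpret lie_algebra F g using assms(3) by (simp add: simple_lie_algebra_def)
  \<comment> \<open>An inclusion rather than an equality: for a small type \<open>'i\<close> there
    may be no r_b-ideal at all, and the span of the empty set is zero too.\<close>
  have "\<Union>{I. rb_ideal TYPE('i) F Lp I} \<subseteq> {\<zero>\<^bsub>Lp\<^esub>}"
    using loop_rb_ideal_zero[OF assms(3)] by blast
  then show ?thesis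
    unfolding baer_radical_def by (rule linear_span_subset_zero[OF loop_module])
qed

end
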